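(* Let $f:\mathbb{R}^n\to\mathbb{R}^n$ be continuous and cyclically firmly nonexpansive, let $A=\mathrm{Id}-f$, let $\ell:\mathbb{R}^n\to\mathbb{R}$ be a convex, differentiable, lower semicontinuous and proper function, let $\mathbf{u}\in\mathbb{R}^n$ be arbitrary and let $\lambda>0$. Then the problem $$\min_{\mathbf{x}\in\mathbb{R}^n}\ E_{\mathrm{Rock}}(\mathbf{x})=\ell(\mathbf{x})+\lambda R_A(\mathbf{x};\mathbf{u}),$$ where $R_A(\cdot;\mathbf{u})$ is the Rockafellar function of $A$, is a convex optimization problem, and the gradient of its objective function is given by $$\nabla E_{\mathrm{Rock}}(\mathbf{x})=\nabla\ell(\mathbf{x})+\lambda\big(\mathbf{x}-f(\mathbf{x})\big)\qquad\text{for all }\mathbf{x}\in\mathbb{R}^n.$$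
   Context: A mapping $f:\mathbb{R}^n\to\mathbb{R}^n$ is cyclically firmly nonexpansive if for every $m\ge 2$ and all points $\mathbf{x}_1,\dots,\mathbf{x}_m\in\mathbb{R}^n$, $$\sum_{i=1}^m\langle \mathbf{x}_i-f(\mathbf{x}_i),\,f(\mathbf{x}_i)-f(\mathbf{x}_{i+1})\rangle\ge 0,\qquad \mathbf{x}_{m+1}=\mathbf{x}_1.$$ For a mapping $A:\mathbb{R}^n\to\mathbb{R}^n$ and a point $\mathbf{u}\in\mathbb{R}^n$, define $C_A^2(\mathbf{x};\mathbf{u})=\langle\mathbf{x},A(\mathbf{u})\rangle-\langle\mathbf{u},A(\mathbf{u})\rangle$ and, for integers $m\ge3$, $$C_A^m(\mathbf{x};\mathbf{u})=\sup_{\mathbf{x}_2,\dots,\mathbf{x}_{m-1}\in\mathbb{R}^n}\ \langle\mathbf{x}-\mathbf{x}_{m-1},A(\mathbf{x}_{m-1})\rangle+\sum_{i=1}^{m-2}\langle\mathbf{x}_{i+1}-\mathbf{x}_i,A(\mathbf{x}_i)\rangle,\qquad \mathbf{x}_1=\mathbf{u}.$$ The Rockafellar function of $A$ with parameter $\mathbf{u}$ is $R_A(\mathbf{x};\mathbf{u})=\sup_{m\in\{2,3,\dots\}}C_A^m(\mathbf{x};\mathbf{u})$. $\mathrm{Id}$ is the identity mapping. *)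

theory Defs
  imports "HOL-Analysis.Analysis"
begin

(* Cycles are sequences indexed from 1; only x 1, ..., x (m + 1) matter. *)
definition cyclically_firmly_nonexpansive :: "('a::real_inner \<Rightarrow> 'a) \<Rightarrow> bool" where
  "cyclically_firmly_nonexpansive f \<longleftrightarrow>
     (\<forall>m\<ge>2. \<forall>x :: nat \<Rightarrow> 'a. x (m + 1) = x 1 \<longrightarrow>
        0 \<le> (\<Sum>i = 1..m. (x i - f (x i)) \<bullet> (f (x i) - f (x (i + 1)))))"

(* The supremum is taken in the extended reals, so that it exists unconditionally; a real-valued
   SUP would be unspecified on unbounded sets. The points are p 1 = u, p 2, ..., p (m - 1); the
   other values of p are irrelevant. Only m \<ge> 2 is meaningful. *)
definition rockafellar_C :: "nat \<Rightarrow> ('a::real_inner \<Rightarrow> 'a) \<Rightarrow> 'a \<Rightarrow> 'a \<Rightarrow> ereal" where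
  "rockafellar_C m A u x =
     (if m = 2 then ereal (x \<bullet> A u - u \<bullet> A u)
      else (SUP p \<in> {p :: nat \<Rightarrow> 'a. p 1 = u}.
              ereal ((x - p (m - 1)) \<bullet> A (p (m - 1))
                     + (\<Sum>i = 1..m - 2. (p (i + 1) - p i) \<bullet> A (p i)))))"

definition rockafellar :: "('a::real_inner \<Rightarrow> 'a) \<Rightarrow> 'a \<Rightarrow> 'a \<Rightarrow> ereal" where
  "rockafellar A u x = (SUP m \<in> {2..}. rockafellar_C m A u x)"

definition E_Rock ::
    "('a::real_inner \<Rightarrow> real) \<Rightarrow> real \<Rightarrow> ('a \<Rightarrow> 'a) \<Rightarrow> 'a \<Rightarrow> 'a \<Rightarrow> ereal" where
  "E_Rock l lam A u x = ereal (l x) + ereal lam * rockafellar A u x"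

definition lower_semicontinuous :: "('a::topological_space \<Rightarrow> ereal) \<Rightarrow> bool" where
  "lower_semicontinuous F \<longleftrightarrow> (\<forall>x. F x \<le> Liminf (at x) F)"

definition proper_function :: "('a \<Rightarrow> ereal) \<Rightarrow> bool" where
  "proper_function F \<longleftrightarrow> (\<forall>x. F x \<noteq> -\<infinity>) \<and> (\<exists>x. F x \<noteq> \<infinity>)"

(* Meaningful only where F is differentiable. *)
definition gradient :: "('a::real_inner \<Rightarrow> real) \<Rightarrow> 'a \<Rightarrow> 'a" where
  "gradient F x = (THE d. GDERIV F x :> d)"

(* Minimising F over S; convex_on includes convexity of the feasible set S. *)
definition convex_optimization_problem :: "'a::real_vector set \<Rightarrow> ('a \<Rightarrow> real) \<Rightarrow> bool" where
  "convex_optimization_problem S F \<longleftrightarrow> convex_on S F"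

end

(* Cyclic firm nonexpansiveness of f makes A = Id - f cyclically monotone. Closing a chain that
   ends in x gives R(x) \<le> (x - u) \<bullet> A x, so R is finite, and prolonging a chain through x
   shows that A x is a subgradient of R at x. Everywhere subdifferentiable functions are convex,
   and a continuous selection of subgradients is the gradient, because
   0 \<le> R(y) - R(x) - (y - x) \<bullet> A x \<le> (y - x) \<bullet> (A y - A x). *)
theory Submission
  imports Defs
begin

definition cyclically_monotone :: "('a::real_inner \<Rightarrow> 'a) \<Rightarrow> bool" where
  "cyclically_monotone A \<longleftrightarrow>
     (\<forall>m\<ge>2. \<forall>x :: nat \<Rightarrow> 'a. x (m + 1) = x 1 \<longrightarrow>
        (\<Sum>i = 1..m. (x (i + 1) - x i) \<bullet> A (x i)) \<le> 0)"

text \<open>With \<open>a i = x i - f (x i)\<close>, each summand of the monotonicity sum is half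
  the increment of \<open>a i \<bullet> a i\<close>, minus the firm nonexpansiveness summand, minus
  half the square of \<open>a (Suc i) - a i\<close>. Around a cycle the increments telescope to
  0.\<close>

lemma cyclically_monotone_id_minus:
  fixes f :: "'a::real_inner \<Rightarrow> 'a"
  assumes "cyclically_firmly_nonexpansive f"
  shows "cyclically_monotone (\<lambda>x. x - f x)"
  unfolding cyclically_monotone_def
proof (intro allI impI)
  fix m :: nat and x :: "nat \<Rightarrow> 'a"
  assume m: "2 \<le> m" and x: "x (m + 1) = x 1"
  define a where "a i = x i - f (x i)" for i
  have nonneg: "0 \<le> (\<Sum>i = 1..m. a i \<bullet> (f (x i) - f (x (i + 1))))"
    using assms m x unfolding cyclically_firmly_nonexpansive_def a_def by blast
  have step: "(x (i + 1) - x i) \<bullet> a i \<le>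
      (a (Suc i) \<bullet> a (Suc i) - a i \<bullet> a i) / 2 - a i \<bullet> (f (x i) - f (x (i + 1)))" for i
  proof -
    have "f (x i) - f (x (i + 1)) = (a (Suc i) - a i) - (x (i + 1) - x i)"
      by (simp add: a_def)
    then have "a i \<bullet> (f (x i) - f (x (i + 1))) =
        a i \<bullet> a (Suc i) - a i \<bullet> a i - (x (i + 1) - x i) \<bullet> a i"
      by (simp add: inner_diff_right inner_commute)
    moreover have "0 \<le> (a (Suc i) - a i) \<bullet> (a (Suc i) - a i)"
      by simp
    ultimately show ?thesis
      by (simp add: inner_diff_left inner_diff_right inner_commute field_simps)
  qed
  have "(\<Sum>i = 1..m. (x (i + 1) - x i) \<bullet> a i) \<le>
      (\<Sum>i = 1..m. (a (Suc i) \<bullet> a (Suc i) - a i \<bullet> a i) / 2 - a i \<bullet> (f (x i) - f (x (i + 1))))"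
    by (rule sum_mono) (rule step)
  also have "\<dots> = (a (Suc m) \<bullet> a (Suc m) - a 1 \<bullet> a 1) / 2
      - (\<Sum>i = 1..m. a i \<bullet> (f (x i) - f (x (i + 1))))"
    using sum_Suc_diff[of 1 m "\<lambda>i. a i \<bullet> a i"]
    by (simp add: sum_subtractf flip: sum_divide_distrib)
  also have "\<dots> \<le> 0"
    using nonneg x by (simp add: a_def)
  finally show "(\<Sum>i = 1..m. (x (i + 1) - x i) \<bullet> (x i - f (x i))) \<le> 0"
    by (simp add: a_def)
qed

text \<open>The expression under the supremum in \<open>rockafellar_C\<close>. At
  \<open>m = 2\<close> its sum is empty and \<open>p (m - 1)\<close> is \<open>p 1\<close>, which
  covers the separate case there.\<close>

definition chain_value :: "('a::real_inner \<Rightarrow> 'a) \<Rightarrow> nat \<Rightarrow> (nat \<Rightarrow> 'a) \<Rightarrow> 'a \<Rightarrow> real" where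
  "chain_value A m p x = (x - p (m - 1)) \<bullet> A (p (m - 1))
     + (\<Sum>i = 1..m - 2. (p (i + 1) - p i) \<bullet> A (p i))"

lemma rockafellar_eq_SUP_chain_value:
  "rockafellar A u x = (SUP m\<in>{2..}. SUP p\<in>{p. p 1 = u}. ereal (chain_value A m p x))"
proof -
  have "rockafellar_C m A u x = (SUP p\<in>{p. p 1 = u}. ereal (chain_value A m p x))" for m
  proof (cases "m = 2")
    case True
    \<comment> \<open>The supremum of a constant is that constant only over a nonempty set.\<close>
    have ne: "{p :: nat \<Rightarrow> 'a. p 1 = u} \<noteq> {}"
      by auto
    have "(SUP p\<in>{p. p 1 = u}. ereal (chain_value A m p x)) =
        (SUP p\<in>{p :: nat \<Rightarrow> 'a. p 1 = u}. ereal (x \<bullet> A u - u \<bullet> A u))"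
      using True by (intro SUP_cong) (auto simp: chain_value_def inner_diff_left)
    also have "\<dots> = ereal (x \<bullet> A u - u \<bullet> A u)"
      by (rule cSUP_const[OF ne])
    finally show ?thesis
      using True by (simp add: rockafellar_C_def)
  next
    case False
    then show ?thesis
      by (simp add: rockafellar_C_def chain_value_def)
  qed
  then show ?thesis
    by (simp add: rockafellar_def)
qed

lemma chain_value_le_rockafellar:
  assumes "2 \<le> m" and "p 1 = u"
  shows "ereal (chain_value A m p x) \<le> rockafellar A u x"
  unfolding rockafellar_eq_SUP_chain_value
  using assms by (intro SUP_upper2[of m] SUP_upper2[of p]) auto

lemma rockafellar_le:
  assumes "\<And>m p. \<lbrakk>2 \<le> m; p 1 = u\<rbrakk> \<Longrightarrow> ereal (chain_value A m p x) \<le> c"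
  shows "rockafellar A u x \<le> c"
  unfolding rockafellar_eq_SUP_chain_value
  using assms by (intro SUP_least) auto

text \<open>Once \<open>x\<close> is appended as point \<open>m\<close>, the old final term becomes
  the last summand and the step from \<open>x\<close> to \<open>y\<close> is the new final
  term.\<close>

lemma chain_value_extend:
  assumes "2 \<le> m"
  shows "chain_value A (Suc m) (p(m := x)) y = chain_value A m p x + (y - x) \<bullet> A x"
proof -
  \<comment> \<open>This form of \<open>m\<close> removes the truncated subtractions. The sum below
    reads indices up to \<open>k + 1\<close> only, so the update at \<open>m\<close> leaves it
    alone.\<close>
  obtain k where k: "m = Suc (Suc k)"
    using le_Suc_ex[OF assms] by auto
  have "(\<Sum>i = 1..k. ((p(m := x)) (i + 1) - (p(m := x)) i) \<bullet> A ((p(m := x)) i)) =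
      (\<Sum>i = 1..k. (p (i + 1) - p i) \<bullet> A (p i))"
    using k by (intro sum.cong) auto
  then show ?thesis
    by (simp add: chain_value_def k)
qed

text \<open>Returning from \<open>x\<close> to \<open>u\<close> closes the chain to a cycle of
  length \<open>m\<close>, whose sum is the chain value plus
  \<open>(u - x) \<bullet> A x\<close>.\<close>

lemma chain_value_le:
  assumes "cyclically_monotone A" and m: "2 \<le> m" and "p 1 = u"
  shows "chain_value A m p x \<le> (x - u) \<bullet> A x"
proof -
  define q where "q = p(m := x, m + 1 := u)"
  obtain k where k: "m = Suc (Suc k)"
    using le_Suc_ex[OF m] by auto
  have "q (m + 1) = q 1"
    using m \<open>p 1 = u\<close> by (simp add: q_def)
  then have "(\<Sum>i = 1..m. (q (i + 1) - q i) \<bullet> A (q i)) \<le> 0"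
    using assms(1) m unfolding cyclically_monotone_def by blast
  moreover have "(\<Sum>i = 1..k. (q (i + 1) - q i) \<bullet> A (q i)) =
      (\<Sum>i = 1..k. (p (i + 1) - p i) \<bullet> A (p i))"
    using k by (intro sum.cong) (auto simp: q_def)
  ultimately have "chain_value A m p x + (u - x) \<bullet> A x \<le> 0"
    by (simp add: chain_value_def k q_def)
  then show ?thesis
    by (simp add: inner_diff_left)
qed

lemma rockafellar_finite:
  assumes "cyclically_monotone A"
  shows "\<bar>rockafellar A u x\<bar> \<noteq> \<infinity>"
proof -
  have "rockafellar A u x \<le> ereal ((x - u) \<bullet> A x)"
    using chain_value_le[OF assms] by (intro rockafellar_le) simp
  \<comment> \<open>A single chain suffices to exclude the value
    \<open>-\<infinity>\<close>.\<close>
  moreover have "ereal (chain_value A 2 (\<lambda>_. u) x) \<le> rockafellar A u x"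
    by (rule chain_value_le_rockafellar) auto
  ultimately show ?thesis
    by (cases "rockafellar A u x") auto
qed

lemma rockafellar_subgradient:
  "rockafellar A u x + ereal ((y - x) \<bullet> A x) \<le> rockafellar A u y"
proof -
  \<comment> \<open>With the finite term moved to the right, the claim bounds a supremum from above
    and can be checked chain by chain.\<close>
  have "rockafellar A u x \<le> rockafellar A u y - ereal ((y - x) \<bullet> A x)"
  proof (rule rockafellar_le)
    fix m :: nat and p :: "nat \<Rightarrow> 'a"
    assume m: "2 \<le> m" and "p 1 = u"
    then have "ereal (chain_value A m p x + (y - x) \<bullet> A x) \<le> rockafellar A u y"
      using chain_value_le_rockafellar[of "Suc m" "p(m := x)" u A y]
      by (simp add: chain_value_extend)
    then show "ereal (chain_value A m p x) \<le> rockafellar A u y - ereal ((y - x) \<bullet> A x)"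
      by (simp add: ereal_le_minus_iff)
  qed
  then show ?thesis
    by (simp add: ereal_le_minus_iff)
qed

text \<open>The subgradient inequalities at the intermediate point \<open>z\<close>, weighted by
  \<open>1 - t\<close> and \<open>t\<close>, add up to convexity because their linear parts
  cancel.\<close>

lemma convex_on_if_subgradients:
  fixes F :: "'a::real_inner \<Rightarrow> real"
  assumes "convex S" and subgrad: "\<And>x y. \<lbrakk>x \<in> S; y \<in> S\<rbrakk> \<Longrightarrow> F x + (y - x) \<bullet> G x \<le> F y"
  shows "convex_on S F"
proof (rule convex_onI)
  fix t :: real and x y :: 'a
  assume t: "0 < t" "t < 1" and S: "x \<in> S" "y \<in> S"
  define z where "z = (1 - t) *\<^sub>R x + t *\<^sub>R y"
  have z: "z \<in> S"
    using \<open>convex S\<close> S t by (simp add: z_def convexD)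
  have "(1 - t) * (F z + (x - z) \<bullet> G z) + t * (F z + (y - z) \<bullet> G z) \<le> (1 - t) * F x + t * F y"
    using t subgrad[OF z] S by (intro add_mono mult_left_mono) auto
  moreover have "(1 - t) * (F z + (x - z) \<bullet> G z) + t * (F z + (y - z) \<bullet> G z) =
      F z + ((1 - t) *\<^sub>R (x - z) + t *\<^sub>R (y - z)) \<bullet> G z"
    by (simp add: inner_add_left algebra_simps)
  moreover have "(1 - t) *\<^sub>R (x - z) + t *\<^sub>R (y - z) = 0"
    by (simp add: z_def algebra_simps)
  ultimately show "F ((1 - t) *\<^sub>R x + t *\<^sub>R y) \<le> (1 - t) * F x + t * F y"
    by (simp add: z_def)
qed (rule assms)

lemma GDERIV_if_continuous_subgradient:
  fixes F :: "'a::real_inner \<Rightarrow> real"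
  assumes subgrad: "\<And>x y. F x + (y - x) \<bullet> G x \<le> F y" and "isCont G x"
  shows "GDERIV F x :> G x"
  unfolding gderiv_def has_derivative_at_alt
proof (intro conjI allI impI)
  show "bounded_linear (\<lambda>h. h \<bullet> G x)"
    by (rule bounded_linear_inner_left)
next
  fix e :: real
  assume "0 < e"
  then obtain d where "0 < d" and d: "\<And>y. norm (y - x) < d \<Longrightarrow> norm (G y - G x) < e"
    using \<open>isCont G x\<close> unfolding continuous_at_eps_delta dist_norm by blast
  have "norm (F y - F x - (y - x) \<bullet> G x) \<le> e * norm (y - x)" if "norm (y - x) < d" for y
  proof -
    have "F y - F x - (y - x) \<bullet> G x \<le> (y - x) \<bullet> (G y - G x)"
      using subgrad[of y x] by (simp add: inner_diff_left inner_diff_right)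
    also have "\<dots> \<le> norm (y - x) * norm (G y - G x)"
      by (rule norm_cauchy_schwarz)
    also have "\<dots> \<le> norm (y - x) * e"
      using d[OF that] by (intro mult_left_mono) auto
    finally show ?thesis
      using subgrad[of x y] by (simp add: mult.commute)
  qed
  with \<open>0 < d\<close> show "\<exists>d>0. \<forall>y. norm (y - x) < d \<longrightarrow>
      norm (F y - F x - (y - x) \<bullet> G x) \<le> e * norm (y - x)"
    by blast
qed

text \<open>The description in \<open>gradient\<close> needs existence and uniqueness. The vector
  representing the functional \<open>D\<close> is its adjoint applied to 1, and a vector is
  determined by its inner products.\<close>

lemma GDERIV_gradient:
  fixes F :: "'a::euclidean_space \<Rightarrow> real"
  assumes "F differentiable (at x)"
  shows "GDERIV F x :> gradient F x"
proof -
  obtain D where D: "(F has_derivative D) (at x)"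
    using assms unfolding differentiable_def by blast
  have "h \<bullet> adjoint D 1 = D h" for h
    using adjoint_works[OF has_derivative_linear[OF D], of h 1] by simp
  then have "GDERIV F x :> adjoint D 1"
    using D by (simp add: gderiv_def)
  moreover have "d = adjoint D 1" if "GDERIV F x :> d" for d
  proof -
    have "(\<lambda>h. h \<bullet> d) = (\<lambda>h. h \<bullet> adjoint D 1)"
      using that \<open>GDERIV F x :> adjoint D 1\<close> unfolding gderiv_def by (rule has_derivative_unique)
    then show ?thesis
      unfolding fun_eq_iff vector_eq_ldot .
  qed
  ultimately show ?thesis
    unfolding gradient_def by (rule theI)
qed

text \<open>Finiteness comes first because \<open>real_of_ereal\<close> sends infinite values to 0;
  it ensures that the other two claims concern the true objective.\<close>

theorem theoremB6:
  fixes f A :: "real ^ 'n \<Rightarrow> real ^ 'n"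
    and l :: "real ^ 'n \<Rightarrow> real"
    and u :: "real ^ 'n"
    and lam :: real
  assumes "continuous_on UNIV f"
    and "cyclically_firmly_nonexpansive f"
    and "A = (\<lambda>x. x - f x)"
    and "convex_on UNIV l"
    and "\<And>x. l differentiable (at x)"
    and "lower_semicontinuous (\<lambda>x. ereal (l x))"
    and "proper_function (\<lambda>x. ereal (l x))"
    and "lam > 0"
  shows "(\<forall>x. \<bar>E_Rock l lam A u x\<bar> \<noteq> \<infinity>)
       \<and> convex_optimization_problem UNIV (\<lambda>x. real_of_ereal (E_Rock l lam A u x))
       \<and> (\<forall>x. GDERIV (\<lambda>y. real_of_ereal (E_Rock l lam A u y)) x :>
                 (gradient l x + lam *\<^sub>R (x - f x)))"
proof -
  define R where "R x = real_of_ereal (rockafellar A u x)" for x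
  have "cyclically_monotone A"
    using cyclically_monotone_id_minus assms(2,3) by simp
  then have R: "rockafellar A u x = ereal (R x)" for x
    unfolding R_def by (rule ereal_real'[symmetric, OF rockafellar_finite])
  then have E: "E_Rock l lam A u x = ereal (l x + lam * R x)" for x
    by (simp add: E_Rock_def)
  have subgrad: "R x + (y - x) \<bullet> A x \<le> R y" for x y
    using rockafellar_subgradient[of A u x y] by (simp add: R)
  have "convex_on UNIV R"
    using subgrad by (intro convex_on_if_subgradients) auto
  then have "convex_on UNIV (\<lambda>x. l x + lam * R x)"
    using assms(4,8) by (intro convex_on_add convex_on_cmul) auto
  moreover have "GDERIV (\<lambda>y. l y + lam * R y) x :> (gradient l x + lam *\<^sub>R (x - f x))" for x
  proof -
    have "isCont A x"
      using assms(1,3) by (auto simp: continuous_on_eq_continuous_at intro!: continuous_intros)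
    then have "GDERIV R x :> A x"
      using subgrad by (rule GDERIV_if_continuous_subgradient[rotated])
    \<comment> \<open>Product rule with a constant factor, whose own gradient is 0.\<close>
    then have "GDERIV (\<lambda>y. lam * R y) x :> lam *\<^sub>R (x - f x)"
      using GDERIV_mult[OF GDERIV_const] assms(3) by fastforce
    with GDERIV_gradient[OF assms(5)] show ?thesis
      by (rule GDERIV_add)
  qed
  ultimately show ?thesis
    by (simp add: E convex_optimization_problem_def)
qed

end
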